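(* Let $\mathsf{Prog}=(\mathit{Var},C,\iota)$ be a probabilistic control-flow program, let $Ex\subseteq\mathit{Var}$, let $\texttt{fail}$ be a guard over $Ex$ (i.e., $\texttt{fail}\in\mathbb{G}(Ex)$), let $k\in\mathbb{N}$, and let $\mathsf{Prog}'$ be the program obtained by applying the reset value optimization (RVO) algorithm to $\mathsf{Prog}$, $Ex$, and some variable evaluation $\rho\in\mathit{Eval}(\mathit{Var})$. Then for every initial variable evaluation $\eta\in[\![\iota]\!]$, $$\Pr\nolimits_{\mathsf{Prog},\eta}[\Diamond^{< k}\texttt{fail}] \;=\; \Pr\nolimits_{\mathsf{Prog}',\eta}[\Diamond^{< k}\texttt{fail}].$$
   Context: A probabilistic control-flow program is a tuple $\mathsf{Prog}=(\mathit{Var},C,\iota)$ with a finite set $\mathit{Var}$ of integer variables, a finite set $C$ of commands, and an initial guard $\iota$ (a Boolean expression over arithmetic constraints on $\mathit{Var}$), with $[\![\iota]\!]$ the set of variable evaluations $\eta\colon\mathit{Var}\to\mathbb{Z}$ satisfying it. A dedicated control-flow variable $\texttt{cf}\notin\mathit{Var}$ is used. Each command has the form $(\texttt{cf}=\ell)\wedge\texttt{guard}\rightarrow \texttt{p}_1:\texttt{update}_1+\dots+\texttt{p}_n:\texttt{update}_n$, where each update is $[\texttt{cf}:=\ell', x_1:=e_1,\dots,x_k:=e_k]$ (each variable updated at most once) and the probability expressions $\texttt{p}_i$ form a distribution whenever the guard holds. Execution starts in $\texttt{cf}=0$ with some $\eta\in[\![\iota]\!]$; among enabled commands one is chosen uniformly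 and one of its updates is applied with the given probability, yielding a discrete-time Markov chain; $\Pr_{\mathsf{Prog},\eta}$ is the standard probability measure on its executions from $\eta$. A round is a return to control-flow location $\texttt{cf}=0$, and $\Diamond^{<k}\texttt{fail}$ is the set of executions reaching a state satisfying $\texttt{fail}$ within $k$ rounds. For a command $c$: $\mathsf{r}(c)$ is the set of variables read in $c$ (in guard, probability expressions, or update expressions), $\mathsf{w}(c)$ the set of variables written in every update of $c$, $\mathsf{cf}(c)$ the control-flow location where $c$ is enabled, and $\mathsf{pred}(c)$ the commands having a control-flow update to $\mathsf{cf}(c)$. Live range analysis computes $\mathsf{live}\colon C\to 2^{\mathit{Var}}$ as the fixpoint obtained by starting from $\mathsf{live}=\mathsf{r}$ and repeatedly setting $\mathsf{live}(c):=\mathsf{live}(c)\cup(\mathsf{live}(c')\setminus\mathsf{w}(c))$ for $c\in\mathsf{pred}(c')$ until no change. The RVO algorithm takes $\mathsf{Prog}$, a reset evaluation $\rho\in\mathit{Eval}(\mathit{Var})$, and a set $Ex\subseteq\mathit{Var}$ of variables excluded from optimization. For each command $c$ and each of its updates $\texttt{p}:[\texttt{cf}:=\ell, xu]$, it computes $L:=\mathsf{live}(c)\setminus Ex$ minus $\mathsf{live}(s)$ for all commands $s$ with $\mathsf{cf}(s)=\ell$; for each $x\in L$ it replaces an existing update $x:=e$ in $xu$ by $x:=\rho(x)$, or adds $x:=\rho(x)$ if $x$ is not updated. Variables and initial guard are unchanged, so $\mathsf{Prog}'=(\mathit{Var},C',\iota)$.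
   Formalization: Commands form a finite multiset instead of a set: commands that become identical under RVO are kept as separate commands. If they were merged into one element of the set C', the uniform choice among enabled commands, and with it the probability of reaching fail, could change. *)

theory Defs
  imports "HOL-Probability.Probability"
begin

section \<open>Expressions, guards and evaluations\<close>

text \<open>
  Operation symbols carry their interpretation, so that expressions over every signature of
  arithmetic operations are covered while the set of occurring variables stays syntactic:
  \<open>avars\<close>, \<open>pvars\<close> and \<open>gvars\<close> are the set functions generated by the datatype package.
\<close>

datatype (avars: 'v) aexp =
    Const int
  | Var 'v
  | Op "int list \<Rightarrow> int" "'v aexp list"

datatype (pvars: 'v) pexp =
    PConst real
  | PInt "'v aexp"
  | POp "real list \<Rightarrow> real" "'v pexp list"

datatype (gvars: 'v) guard =
    TT
  | Cmp "int \<Rightarrow> int \<Rightarrow> bool" "'v aexp" "'v aexp"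
  | GNot "'v guard"
  | GAnd "'v guard" "'v guard"
  | GOr "'v guard" "'v guard"

type_synonym 'v eval = "'v \<Rightarrow> int"

definition Eval :: "'v set \<Rightarrow> 'v eval set" where
  "Eval V = V \<rightarrow>\<^sub>E UNIV"

primrec aval :: "'v eval \<Rightarrow> 'v aexp \<Rightarrow> int" where
  "aval \<eta> (Const z) = z"
| "aval \<eta> (Var x) = \<eta> x"
| "aval \<eta> (Op f es) = f (map (aval \<eta>) es)"

primrec pval :: "'v eval \<Rightarrow> 'v pexp \<Rightarrow> real" where
  "pval \<eta> (PConst r) = r"
| "pval \<eta> (PInt e) = of_int (aval \<eta> e)"
| "pval \<eta> (POp f es) = f (map (pval \<eta>) es)"

primrec sat :: "'v eval \<Rightarrow> 'v guard \<Rightarrow> bool" where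
  "sat \<eta> TT \<longleftrightarrow> True"
| "sat \<eta> (Cmp R a b) \<longleftrightarrow> R (aval \<eta> a) (aval \<eta> b)"
| "sat \<eta> (GNot g) \<longleftrightarrow> \<not> sat \<eta> g"
| "sat \<eta> (GAnd g h) \<longleftrightarrow> sat \<eta> g \<and> sat \<eta> h"
| "sat \<eta> (GOr g h) \<longleftrightarrow> sat \<eta> g \<or> sat \<eta> h"

definition Guards :: "'v set \<Rightarrow> 'v guard set" where
  "Guards V = {g. gvars g \<subseteq> V}"


section \<open>Probabilistic control-flow programs\<close>

text \<open>
  The variable \<open>cf\<close> is not among the program variables: its value is a separate component of
  updates, commands and states. An update maps each variable to at most one expression.
\<close>

datatype 'v update = Update (target: int) (assigns: "'v \<rightharpoonup> 'v aexp")

datatype 'v command = Command (cf: int) (grd: "'v guard") (branches: "('v pexp \<times> 'v update) list")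

text \<open>
  The commands form a multiset; a program given by a set \<open>C\<close> of commands is represented by
  \<open>mset_set C\<close>. Program transformations work command by command and may make two different
  commands syntactically equal. These must still count as two commands in the uniform choice
  among the enabled commands: collapsing them would change the probabilities.
\<close>

datatype 'v program = Program (vars: "'v set") (cmds: "'v command multiset") (init: "'v guard")

definition init_evals :: "'v program \<Rightarrow> 'v eval set" where
  "init_evals P = {\<eta> \<in> Eval (vars P). sat \<eta> (init P)}"

definition read_vars :: "'v command \<Rightarrow> 'v set" where
  "read_vars c = gvars (grd c) \<union>
     (\<Union>(p, u) \<in> set (branches c). pvars p \<union> (\<Union>e \<in> ran (assigns u). avars e))"

definition written_vars :: "'v command \<Rightarrow> 'v set" where
  "written_vars c = {x. \<forall>(p, u) \<in> set (branches c). x \<in> dom (assigns u)}"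

definition program :: "'v program \<Rightarrow> bool" where
  "program P \<longleftrightarrow>
     finite (vars P) \<and> init P \<in> Guards (vars P) \<and>
     (\<forall>c \<in># cmds P.
        read_vars c \<subseteq> vars P \<and>
        (\<forall>(p, u) \<in> set (branches c). dom (assigns u) \<subseteq> vars P) \<and>
        (\<forall>\<eta> \<in> Eval (vars P). sat \<eta> (grd c) \<longrightarrow>
           pmf_of_list_wf (map (\<lambda>(p, u). (u, pval \<eta> p)) (branches c))))"


section \<open>Markov chain semantics\<close>

type_synonym 'v state = "int \<times> 'v eval"

definition apply_update :: "'v update \<Rightarrow> 'v eval \<Rightarrow> 'v state" where
  "apply_update u \<eta> =
     (target u, \<lambda>x. case assigns u x of None \<Rightarrow> \<eta> x | Some e \<Rightarrow> aval \<eta> e)"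

definition enabled :: "'v program \<Rightarrow> 'v state \<Rightarrow> 'v command multiset" where
  "enabled P s = filter_mset (\<lambda>c. cf c = fst s \<and> sat (snd s) (grd c)) (cmds P)"

text \<open>States without enabled commands are made absorbing.\<close>

definition step :: "'v program \<Rightarrow> 'v state \<Rightarrow> 'v state pmf" where
  "step P s =
     (if enabled P s = {#} then return_pmf s
      else do {
        c \<leftarrow> pmf_of_multiset (enabled P s);
        u \<leftarrow> pmf_of_list (map (\<lambda>(p, u). (u, pval (snd s) p)) (branches c));
        return_pmf (apply_update u (snd s))
      })"

text \<open>
  The measure on executions is the Ionescu-Tulcea extension of the initial Dirac distribution
  and the one-step kernel, on infinite sequences of states with the product \<open>\<sigma>\<close>-algebra.
\<close>

fun kernel :: "'v program \<Rightarrow> 'v eval \<Rightarrow> nat \<Rightarrow> (nat \<Rightarrow> 'v state) \<Rightarrow> 'v state measure" where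
  "kernel P \<eta> 0 \<omega> = measure_pmf (return_pmf (0, \<eta>))"
| "kernel P \<eta> (Suc n) \<omega> = measure_pmf (step P (\<omega> n))"

definition exec_measure :: "'v program \<Rightarrow> 'v eval \<Rightarrow> (nat \<Rightarrow> 'v state) measure" where
  "exec_measure P \<eta> =
     projective_family.lim UNIV
       (Ionescu_Tulcea.CI (kernel P \<eta>) (\<lambda>_. count_space UNIV)) (\<lambda>_. count_space UNIV)"

lemma Ionescu_Tulcea_kernel:
  fixes P :: "'v program"
  shows "Ionescu_Tulcea (kernel P \<eta>) (\<lambda>_. count_space UNIV)"
proof (rule Ionescu_Tulcea.intro)
  fix i :: nat
  show "kernel P \<eta> i \<in> measurable (PiM {0..<i} (\<lambda>_. count_space UNIV))
          (subprob_algebra (count_space UNIV))"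
  proof (cases i)
    case 0
    have "measure_pmf (return_pmf (0, \<eta>)) \<in> space (subprob_algebra (count_space UNIV))"
      by (rule measure_pmf_in_subprob_algebra)
    then show ?thesis
      using 0 by (subst measurable_cong[where g = "\<lambda>_. measure_pmf (return_pmf (0, \<eta>))"]) auto
  next
    case (Suc n)
    have 1: "(\<lambda>\<omega>. \<omega> n) \<in> measurable (PiM {0..<i} (\<lambda>_. count_space (UNIV :: 'v state set)))
               (count_space UNIV)"
      using Suc by (intro measurable_component_singleton) auto
    have 2: "(\<lambda>s. measure_pmf (step P s)) \<in> measurable (count_space UNIV)
               (subprob_algebra (count_space UNIV))"
      by (auto intro: measure_pmf_in_subprob_algebra)
    show ?thesis
      using measurable_compose[OF 1 2] Suc
      by (subst measurable_cong[where g = "\<lambda>\<omega>. measure_pmf (step P (\<omega> n))"]) auto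
  qed
next
  fix i :: nat and \<omega> :: "nat \<Rightarrow> 'v state"
  show "prob_space (kernel P \<eta> i \<omega>)"
    by (cases i) (auto intro: measure_pmf.prob_space_axioms)
qed

text \<open>
  A round ends with each transition into location \<open>0\<close>; the initial state is not a return.
\<close>

definition reach_within :: "nat \<Rightarrow> 'v guard \<Rightarrow> (nat \<Rightarrow> 'v state) set" where
  "reach_within k g =
     {\<omega>. \<exists>n. sat (snd (\<omega> n)) g \<and> card {i \<in> {1..n}. fst (\<omega> i) = 0} < k}"

lemma sets_exec_measure: "sets (exec_measure P \<eta>) = sets (PiM UNIV (\<lambda>_. count_space UNIV))"
proof -
  interpret Ionescu_Tulcea "kernel P \<eta>" "\<lambda>_. count_space UNIV"
    by (rule Ionescu_Tulcea_kernel)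
  show ?thesis
    unfolding exec_measure_def by (rule PF.sets_lim)
qed

lemma reach_within_measurable:
  fixes P :: "'v program"
  shows "reach_within k g \<in> sets (exec_measure P \<eta>)"
proof -
  have pred: "Measurable.pred (PiM UNIV (\<lambda>_. count_space UNIV)) (\<lambda>\<omega>. f (\<omega> i))"
    for f :: "'v state \<Rightarrow> bool" and i :: nat
    by (rule measurable_compose[OF measurable_component_singleton]) auto
  have [measurable]: "Measurable.pred (PiM UNIV (\<lambda>_. count_space UNIV))
                        (\<lambda>\<omega> :: nat \<Rightarrow> 'v state. sat (snd (\<omega> n)) g)" for n
    by (rule pred[where f = "\<lambda>s. sat (snd s) g"])
  have [measurable]: "Measurable.pred (PiM UNIV (\<lambda>_. count_space UNIV))
                        (\<lambda>\<omega> :: nat \<Rightarrow> 'v state. fst (\<omega> i) = 0)" for i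
    by (rule pred[where f = "\<lambda>s. fst s = 0"])
  have card_iff: "card {i \<in> {1..n}. fst (\<omega> i) = 0} < k \<longleftrightarrow>
          (\<exists>T \<in> {T \<in> Pow {1..n}. card T < k}. \<forall>i \<in> {1..n}. fst (\<omega> i) = 0 \<longleftrightarrow> i \<in> T)" 
      (is "?l \<longleftrightarrow> ?r")
    for \<omega> :: "nat \<Rightarrow> 'v state" and n
  proof
    assume ?l
    then show ?r
      by (intro bexI[of _ "{i \<in> {1..n}. fst (\<omega> i) = 0}"]) auto
  next
    assume ?r
    then obtain T where "T \<subseteq> {1..n}" "card T < k"
        "\<forall>i \<in> {1..n}. fst (\<omega> i) = 0 \<longleftrightarrow> i \<in> T"
      by blast
    moreover from this have "{i \<in> {1..n}. fst (\<omega> i) = 0} = T"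
      by blast
    ultimately show ?l
      by simp
  qed
  have "Measurable.pred (PiM UNIV (\<lambda>_. count_space UNIV))
      (\<lambda>\<omega> :: nat \<Rightarrow> 'v state. \<exists>n. sat (snd (\<omega> n)) g \<and>
        (\<exists>T \<in> {T \<in> Pow {1..n}. card T < k}. \<forall>i \<in> {1..n}. fst (\<omega> i) = 0 \<longleftrightarrow> i \<in> T))"
    by (intro pred_intros_countable pred_intros_logic pred_intros_finite) auto
  then have "{\<omega> \<in> space (PiM (UNIV :: nat set) (\<lambda>_. count_space UNIV)).
           \<exists>n. sat (snd (\<omega> n)) g \<and> card {i \<in> {1..n}. fst (\<omega> i) = 0} < k}
         \<in> sets (PiM UNIV (\<lambda>_. count_space (UNIV :: 'v state set)))"
    by (simp only: pred_def card_iff)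
  then show ?thesis
    by (simp add: sets_exec_measure reach_within_def space_PiM del: One_nat_def)
qed


section \<open>Live range analysis and reset value optimization\<close>

definition pred_cmds :: "'v program \<Rightarrow> 'v command \<Rightarrow> 'v command set" where
  "pred_cmds P c' = {c. c \<in># cmds P \<and> (\<exists>(p, u) \<in> set (branches c). target u = cf c')}"

text \<open>
  The least family of sets containing \<open>read_vars\<close> and closed under the propagation rule; this
  is where the iterative computation stops, see \<open>live_eqI\<close>.
\<close>

inductive live_in :: "'v program \<Rightarrow> 'v command \<Rightarrow> 'v \<Rightarrow> bool" for P :: "'v program" where
  live_read: "x \<in> read_vars c \<Longrightarrow> live_in P c x"
| live_prop: "live_in P c x"
    if "c' \<in># cmds P" "c \<in> pred_cmds P c'" "live_in P c' x" "x \<notin> written_vars c"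

definition live :: "'v program \<Rightarrow> 'v command \<Rightarrow> 'v set" where
  "live P c = {x. live_in P c x}"

inductive live_step ::
  "'v program \<Rightarrow> ('v command \<Rightarrow> 'v set) \<Rightarrow> ('v command \<Rightarrow> 'v set) \<Rightarrow> bool"
  for P :: "'v program" where
  "c' \<in># cmds P \<Longrightarrow> c \<in> pred_cmds P c' \<Longrightarrow>
     live_step P l (l(c := l c \<union> (l c' - written_vars c)))"

lemma live_eqI:
  assumes "(live_step P)\<^sup>*\<^sup>* read_vars l" and stable: "\<And>l'. live_step P l l' \<Longrightarrow> l' = l"
  shows "live P = l"
proof -
  have "(\<forall>c. read_vars c \<subseteq> l c) \<and> (\<forall>c. l c \<subseteq> live P c)"
    using assms(1)
  proof (induction rule: rtranclp_induct)
    case base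
    then show ?case by (auto simp: live_def intro: live_read)
  next
    case (step l l')
    from step.hyps(2) show ?case
    proof cases
      case (1 c' c)
      then show ?thesis
        using step.IH live_prop[OF 1(2,3)] by (auto simp: live_def subset_iff)
    qed
  qed
  moreover have "x \<in> l c" if "live_in P c x" for c x
    using that
  proof induction
    case (live_read x c)
    then show ?case using calculation by auto
  next
    case (live_prop c' c x)
    have "l(c := l c \<union> (l c' - written_vars c)) = l"
      using live_prop.hyps by (intro stable live_step.intros)
    then have "l c = l c \<union> (l c' - written_vars c)"
      by (metis fun_upd_same)
    then show ?case using live_prop by blast
  qed
  ultimately show ?thesis by (fastforce simp: live_def)
qed

definition reset_set :: "'v program \<Rightarrow> 'v set \<Rightarrow> 'v command \<Rightarrow> 'v update \<Rightarrow> 'v set" where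
  "reset_set P Exc c u = (live P c - Exc) - (\<Union>s \<in> {s. s \<in># cmds P \<and> cf s = target u}. live P s)"

definition rvo_update ::
  "'v program \<Rightarrow> 'v eval \<Rightarrow> 'v set \<Rightarrow> 'v command \<Rightarrow> 'v update \<Rightarrow> 'v update" where
  "rvo_update P \<rho> Exc c u =
     Update (target u)
       (\<lambda>x. if x \<in> reset_set P Exc c u then Some (Const (\<rho> x)) else assigns u x)"

definition rvo_command :: "'v program \<Rightarrow> 'v eval \<Rightarrow> 'v set \<Rightarrow> 'v command \<Rightarrow> 'v command" where
  "rvo_command P \<rho> Exc c =
     Command (cf c) (grd c) (map (\<lambda>(p, u). (p, rvo_update P \<rho> Exc c u)) (branches c))"

definition rvo :: "'v program \<Rightarrow> 'v eval \<Rightarrow> 'v set \<Rightarrow> 'v program" where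
  "rvo P \<rho> Exc = Program (vars P) (image_mset (rvo_command P \<rho> Exc) (cmds P)) (init P)"

end

theory Submission
  imports Defs
begin

text \<open>
  Two states are related if they have the same location and agree on \<open>Exc\<close> and on all variables
  that are live at that location. An update resets only variables that are live neither at its
  target nor in \<open>Exc\<close>, so this relation is a probabilistic bisimulation between the program and its
  optimization, and it preserves \<open>fail\<close> and the visits of location \<open>0\<close>. Bisimilar programs give the
  same probability to every event that is determined by a finite prefix and invariant under the
  relation, and the reachability event is the increasing union of such events.
\<close>

section \<open>Probability mass functions\<close>

text \<open>At each \<open>y\<close> both sides add up the weights of the list entries whose first
  component \<open>f\<close> sends to \<open>y\<close>. Injectivity of \<open>f\<close> is not
  assumed, since resetting may make two updates of a command equal.\<close>

lemma pmf_of_list_map_fst: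
  assumes "pmf_of_list_wf xs"
  shows "pmf_of_list (map (map_prod f id) xs) = map_pmf f (pmf_of_list xs)"
proof (rule pmf_eqI)
  fix y
  have wf: "pmf_of_list_wf (map (map_prod f id) xs)"
    using assms by (force simp: pmf_of_list_wf_def comp_def)
  show "pmf (pmf_of_list (map (map_prod f id) xs)) y = pmf (map_pmf f (pmf_of_list xs)) y"
    unfolding pmf_map measure_pmf_of_list[OF assms] pmf_pmf_of_list[OF wf]
    by (simp add: filter_map comp_def)
qed

text \<open>Multiplicities add up over the fibres of \<open>f\<close>, so commands that become equal
  after optimization keep their joint weight in the uniform choice.\<close>

lemma pmf_of_multiset_image:
  assumes "M \<noteq> {#}"
  shows "pmf_of_multiset (image_mset f M) = map_pmf f (pmf_of_multiset M)"
proof (rule pmf_eqI)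
  fix y
  have "pmf (map_pmf f (pmf_of_multiset M)) y =
      measure (pmf_of_multiset M) (f -` {y} \<inter> set_mset M)"
    using assms measure_Int_set_pmf[of "pmf_of_multiset M" "f -` {y}"] by (simp add: pmf_map)
  also have "\<dots> = (\<Sum>x\<in>f -` {y} \<inter> set_mset M. count M x / size M)"
    using assms by (simp add: measure_measure_pmf_finite)
  also have "\<dots> = count (image_mset f M) y / size M"
    by (simp add: count_image_mset sum_divide_distrib)
  finally show "pmf (pmf_of_multiset (image_mset f M)) y = pmf (map_pmf f (pmf_of_multiset M)) y"
    using assms by simp
qed

text \<open>Both integrals are taken over the coupling, where the integrands agree on the
  support.\<close>

lemma nn_integral_rel_pmf:
  assumes "rel_pmf R p q" and "\<And>x y. R x y \<Longrightarrow> f x = g y"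
  shows "(\<integral>\<^sup>+x. f x \<partial>measure_pmf p) = (\<integral>\<^sup>+y. g y \<partial>measure_pmf q)"
  using assms(1)
proof cases
  case (1 pq)
  have "(\<integral>\<^sup>+z. f (fst z) \<partial>measure_pmf pq) = (\<integral>\<^sup>+z. g (snd z) \<partial>measure_pmf pq)"
    by (intro nn_integral_cong_AE) (auto simp: AE_measure_pmf_iff intro!: assms(2) 1(1))
  then show ?thesis
    by (simp flip: 1(2,3))
qed


section \<open>Bisimilar programs\<close>

abbreviation exec_prefixes :: "'v program \<Rightarrow> 'v eval \<Rightarrow> nat \<Rightarrow> (nat \<Rightarrow> 'v state) measure" where
  "exec_prefixes P \<eta> n \<equiv>
     Ionescu_Tulcea.C (kernel P \<eta>) (\<lambda>_. count_space UNIV) 0 n (\<lambda>_. undefined)"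

text \<open>Integrates out the last state of a prefix. The measurability claim allows this to be
  iterated on the inner integral.\<close>

lemma nn_integral_exec_prefixes_Suc:
  fixes f :: "(nat \<Rightarrow> 'v state) \<Rightarrow> ennreal"
  assumes f: "f \<in> borel_measurable (PiM {0..<Suc n} (\<lambda>_. count_space UNIV))"
  shows "(\<lambda>\<omega>. \<integral>\<^sup>+s. f (fun_upd \<omega> n s) \<partial>kernel P \<eta> n \<omega>)
      \<in> borel_measurable (PiM {0..<n} (\<lambda>_. count_space UNIV))"
    and "(\<integral>\<^sup>+\<omega>. f \<omega> \<partial>exec_prefixes P \<eta> (Suc n)) =
      (\<integral>\<^sup>+\<omega>. (\<integral>\<^sup>+s. f (fun_upd \<omega> n s) \<partial>kernel P \<eta> n \<omega>) \<partial>exec_prefixes P \<eta> n)"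
proof -
  interpret Ionescu_Tulcea "kernel P \<eta>" "\<lambda>_. count_space UNIV"
    by (rule Ionescu_Tulcea_kernel)
  let ?M = "\<lambda>J. PiM J (\<lambda>_. count_space UNIV) :: (nat \<Rightarrow> 'v state) measure"
  have [simp]: "(\<lambda>_. undefined) \<in> space (?M {0..<0})"
    by (simp add: space_PiM)
  \<comment> \<open>\<open>eP n\<close> maps a prefix of length \<open>n\<close> to the law of its
    extension by one state drawn from the kernel.\<close>
  have "(\<lambda>\<omega>. \<integral>\<^sup>+\<omega>'. f \<omega>' \<partial>eP n \<omega>) \<in> borel_measurable (?M {0..<n})"
    using f by measurable
  then show "(\<lambda>\<omega>. \<integral>\<^sup>+s. f (fun_upd \<omega> n s) \<partial>kernel P \<eta> n \<omega>) \<in> borel_measurable (?M {0..<n})"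
    by (rule measurable_cong[THEN iffD1, rotated]) (rule nn_integral_eP[OF _ f])
  have "sets (exec_prefixes P \<eta> n) = sets (?M {0..<n})"
    by (subst sets_C) auto
  then have "eP n \<in> measurable (exec_prefixes P \<eta> n) (subprob_algebra (?M {0..<Suc n}))"
    using measurable_eP[of n] by (simp cong: measurable_cong_sets)
  then have "(\<integral>\<^sup>+\<omega>. f \<omega> \<partial>exec_prefixes P \<eta> (Suc n)) =
      (\<integral>\<^sup>+\<omega>. (\<integral>\<^sup>+\<omega>'. f \<omega>' \<partial>eP n \<omega>) \<partial>exec_prefixes P \<eta> n)"
    using f by (simp add: nn_integral_bind)
  also have "\<dots> = (\<integral>\<^sup>+\<omega>. (\<integral>\<^sup>+s. f (fun_upd \<omega> n s) \<partial>kernel P \<eta> n \<omega>) \<partial>exec_prefixes P \<eta> n)"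
    by (intro nn_integral_cong nn_integral_eP f) (simp add: space_C)
  finally show "(\<integral>\<^sup>+\<omega>. f \<omega> \<partial>exec_prefixes P \<eta> (Suc n)) = \<dots>" .
qed

text \<open>The set on the left is a cylinder, and on cylinders the projective limit has its
  finite-dimensional marginals as values. \<open>restrict\<close> appears because the members of
  \<open>X\<close> are extensional.\<close>

lemma emeasure_exec_measure_prefix:
  fixes X :: "(nat \<Rightarrow> 'v state) set"
  assumes X: "X \<in> sets (PiM {0..<n} (\<lambda>_. count_space UNIV))"
  shows "emeasure (exec_measure P \<eta>) {\<omega>. restrict \<omega> {0..<n} \<in> X} =
      (\<integral>\<^sup>+\<omega>. indicator X \<omega> \<partial>exec_prefixes P \<eta> n)"
proof -
  interpret Ionescu_Tulcea "kernel P \<eta>" "\<lambda>_. count_space UNIV"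
    by (rule Ionescu_Tulcea_kernel)
  have "{\<omega>. restrict \<omega> {0..<n} \<in> X} = PF.emb UNIV {0..<n} X"
    by (auto simp: prod_emb_def)
  then have "emeasure (exec_measure P \<eta>) {\<omega>. restrict \<omega> {0..<n} \<in> X} = emeasure (CI {0..<n}) X"
    using lim[OF _ X] by (simp add: exec_measure_def)
  also have "\<dots> = emeasure (exec_prefixes P \<eta> n) X"
    using X sets.sets_into_space[OF X]
    by (subst emeasure_CI[of _ n]) (simp_all add: prod_emb_id space_PiM)
  also have "\<dots> = (\<integral>\<^sup>+\<omega>. indicator X \<omega> \<partial>exec_prefixes P \<eta> n)"
    using X by (intro nn_integral_indicator[symmetric]) (subst sets_C, auto simp: space_PiM)
  finally show ?thesis .
qed

text \<open>Induction on the length. \<open>f\<close> and \<open>g\<close> vary because the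
  induction hypothesis is applied to their integrals over the last state, which again agree on
  related prefixes.\<close>

lemma nn_integral_exec_prefixes_bisim:
  fixes P Q :: "'v program" and f g :: "(nat \<Rightarrow> 'v state) \<Rightarrow> ennreal"
  assumes init: "R (0, \<eta>) (0, \<theta>)"
    and step: "\<And>s t. R s t \<Longrightarrow> rel_pmf R (step P s) (step Q t)"
    and "f \<in> borel_measurable (PiM {0..<n} (\<lambda>_. count_space UNIV))"
    and "g \<in> borel_measurable (PiM {0..<n} (\<lambda>_. count_space UNIV))"
    and "\<And>\<omega> \<omega>'. \<lbrakk>\<And>i. i < n \<Longrightarrow> R (\<omega> i) (\<omega>' i);
        \<omega> \<in> extensional {0..<n}; \<omega>' \<in> extensional {0..<n}\<rbrakk> \<Longrightarrow> f \<omega> = g \<omega>'"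
  shows "(\<integral>\<^sup>+\<omega>. f \<omega> \<partial>exec_prefixes P \<eta> n) = (\<integral>\<^sup>+\<omega>. g \<omega> \<partial>exec_prefixes Q \<theta> n)"
  using assms(3-5)
proof (induction n arbitrary: f g)
  case 0
  interpret P: Ionescu_Tulcea "kernel P \<eta>" "\<lambda>_. count_space UNIV"
    by (rule Ionescu_Tulcea_kernel)
  interpret Q: Ionescu_Tulcea "kernel Q \<theta>" "\<lambda>_. count_space UNIV"
    by (rule Ionescu_Tulcea_kernel)
  \<comment> \<open>Both laws are Dirac at the empty prefix.\<close>
  from 0 show ?case
    by (simp add: nn_integral_return space_PiM)
next
  case (Suc n)
  show ?case
    unfolding nn_integral_exec_prefixes_Suc(2)[OF Suc.prems(1)]
      nn_integral_exec_prefixes_Suc(2)[OF Suc.prems(2)]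
  proof (intro Suc.IH nn_integral_exec_prefixes_Suc(1) Suc.prems(1,2))
    fix \<omega> \<omega>' :: "nat \<Rightarrow> 'v state"
    assume R: "R (\<omega> i) (\<omega>' i)" if "i < n" for i
    assume "\<omega> \<in> extensional {0..<n}" "\<omega>' \<in> extensional {0..<n}"
    then have ext: "fun_upd \<omega> n s \<in> extensional {0..<Suc n}" "fun_upd \<omega>' n s \<in> extensional {0..<Suc n}" for s
      by (auto simp: extensional_def)
    have fg: "f (fun_upd \<omega> n s) = g (fun_upd \<omega>' n t)" if "R s t" for s t
      using that R by (intro Suc.prems(3) ext) (auto simp: less_Suc_eq)
    show "(\<integral>\<^sup>+s. f (fun_upd \<omega> n s) \<partial>kernel P \<eta> n \<omega>) = (\<integral>\<^sup>+s. g (fun_upd \<omega>' n s) \<partial>kernel Q \<theta> n \<omega>')"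
    \<comment> \<open>The state at index 0 comes from the Dirac kernel and is covered by
      \<open>init\<close>; each later one is drawn by \<open>step\<close> from its predecessor at
      index \<open>m\<close>, which is already related.\<close>
    proof (cases n)
      case 0
      then show ?thesis
        using fg[OF init] by simp
    next
      case (Suc m)
      then show ?thesis
        using nn_integral_rel_pmf[OF step[OF R], of m] fg by simp
    qed
  qed
qed

text \<open>A finite product of countable discrete spaces is discrete, so every predicate on
  observed prefixes becomes measurable. The states themselves may form an uncountable type.\<close>

lemma measurable_observation_prefix:
  fixes h :: "'a \<Rightarrow> 'b :: countable"
  assumes "finite I"
  shows "(\<lambda>\<omega>. \<lambda>i\<in>I. h (\<omega> i)) \<in> measurable (PiM I (\<lambda>_. count_space UNIV))
      (count_space (PiE I (\<lambda>_. UNIV)))"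
proof -
  have "(\<lambda>\<omega>. \<lambda>i\<in>I. h (\<omega> i)) \<in> measurable (PiM I (\<lambda>_. count_space UNIV))
      (PiM I (\<lambda>_. count_space UNIV))"
    by (intro measurable_restrict measurable_compose[OF measurable_component_singleton]) auto
  then show ?thesis
    using assms by (simp add: count_space_PiM_finite)
qed

text \<open>The components of \<open>a i\<close> stand for being at location 0 and satisfying the
  guard. As \<open>m < n\<close>, only the first \<open>n\<close> observations matter.\<close>

definition reaches_before :: "nat \<Rightarrow> nat \<Rightarrow> (nat \<Rightarrow> bool \<times> bool) \<Rightarrow> bool" where
  "reaches_before n k a \<longleftrightarrow> (\<exists>m<n. snd (a m) \<and> card {i \<in> {1..m}. fst (a i)} < k)"

lemma reaches_before_cong:
  assumes "\<And>i. i < n \<Longrightarrow> a i = b i"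
  shows "reaches_before n k a \<longleftrightarrow> reaches_before n k b"
proof -
  have "{i \<in> {1..m}. fst (a i)} = {i \<in> {1..m}. fst (b i)}" if "m < n" for m
    using assms that by (intro Collect_cong) auto
  then show ?thesis
    using assms by (simp add: reaches_before_def cong: conj_cong)
qed

text \<open>Related prefixes have equal observations, so the events \<open>E n\<close> have equal
  measure in both chains; continuity from below passes to their union.\<close>

lemma measure_reach_within_bisim:
  fixes P Q :: "'v program"
  assumes init: "R (0, \<eta>) (0, \<theta>)"
    and step: "\<And>s t. R s t \<Longrightarrow> rel_pmf R (step P s) (step Q t)"
    and loc: "\<And>s t. R s t \<Longrightarrow> fst s = fst t"
    and obs: "\<And>s t. R s t \<Longrightarrow> sat (snd s) g \<longleftrightarrow> sat (snd t) g"
  shows "measure (exec_measure P \<eta>) (reach_within k g) =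
         measure (exec_measure Q \<theta>) (reach_within k g)"
proof -
  let ?M = "\<lambda>J. PiM J (\<lambda>_. count_space UNIV) :: (nat \<Rightarrow> 'v state) measure"
  define h where "h s = (fst s = 0, sat (snd s) g)" for s :: "'v state"
  define E where "E n = {\<omega>. reaches_before n k (\<lambda>i. h (\<omega> i))}" for n
  define X where "X n = E n \<inter> space (?M {0..<n})" for n
  \<comment> \<open>As a preimage under the observation map, \<open>X n\<close> is
    measurable.\<close>
  have X_alt: "X n = (\<lambda>\<omega>. \<lambda>i\<in>{0..<n}. h (\<omega> i)) -` {a \<in> PiE {0..<n} (\<lambda>_. UNIV). reaches_before n k a}
      \<inter> space (?M {0..<n})" for n
    by (auto simp: X_def E_def cong: reaches_before_cong)
  have X: "X n \<in> sets (?M {0..<n})" for n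
    unfolding X_alt by (rule measurable_sets[OF measurable_observation_prefix]) auto
  have E_eq: "E n = {\<omega>. restrict \<omega> {0..<n} \<in> X n}" for n
    by (auto simp: X_def E_def space_PiM cong: reaches_before_cong)
  have sets_E: "E n \<in> sets (exec_measure S \<zeta>)" for n and S :: "'v program" and \<zeta>
  proof -
    have "E n = (\<lambda>\<omega>. restrict \<omega> {0..<n}) -` X n \<inter> space (?M UNIV)"
      by (auto simp: E_eq space_PiM)
    also have "\<dots> \<in> sets (?M UNIV)"
      by (rule measurable_sets[OF measurable_restrict_subset X]) auto
    finally show ?thesis
      by (simp add: sets_exec_measure)
  qed
  have "incseq E"
    by (auto simp: incseq_def E_def reaches_before_def intro: less_le_trans)
  moreover have "reach_within k g = (\<Union>n. E n)"
    by (auto simp: reach_within_def E_def reaches_before_def h_def simp del: One_nat_def)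
  ultimately have sup: "emeasure (exec_measure S \<zeta>) (reach_within k g) =
      (SUP n. emeasure (exec_measure S \<zeta>) (E n))" for S :: "'v program" and \<zeta>
    using sets_E by (subst SUP_emeasure_incseq) auto
  have "emeasure (exec_measure P \<eta>) (E n) = emeasure (exec_measure Q \<theta>) (E n)" for n
  proof -
    have "h s = h t" if "R s t" for s t
      using loc[OF that] obs[OF that] by (simp add: h_def)
    then have "reaches_before n k (\<lambda>i. h (\<omega> i)) \<longleftrightarrow> reaches_before n k (\<lambda>i. h (\<omega>' i))"
      if "\<And>i. i < n \<Longrightarrow> R (\<omega> i) (\<omega>' i)" for \<omega> \<omega>'
      using that by (intro reaches_before_cong) auto
    then have "(\<integral>\<^sup>+\<omega>. indicator (X n) \<omega> \<partial>exec_prefixes P \<eta> n) =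
        (\<integral>\<^sup>+\<omega>. indicator (X n) \<omega> \<partial>exec_prefixes Q \<theta> n)"
      using init step X
      by (intro nn_integral_exec_prefixes_bisim[where R = R] borel_measurable_indicator)
        (auto simp: X_def E_def space_PiM PiE_def indicator_def)
    then show ?thesis
      unfolding E_eq by (simp only: emeasure_exec_measure_prefix[OF X])
  qed
  then show ?thesis
    by (simp add: measure_def sup)
qed


section \<open>Reset value optimization\<close>

lemma aval_cong: "(\<And>x. x \<in> avars e \<Longrightarrow> \<eta> x = \<theta> x) \<Longrightarrow> aval \<eta> e = aval \<theta> e"
proof (induction e)
  case (Op f es)
  then have "map (aval \<eta>) es = map (aval \<theta>) es"
    by (intro map_cong) auto
  then show ?case
    by (simp only: aval.simps)
qed auto

lemma pval_cong: "(\<And>x. x \<in> pvars e \<Longrightarrow> \<eta> x = \<theta> x) \<Longrightarrow> pval \<eta> e = pval \<theta> e"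
proof (induction e)
  case (PInt e)
  then show ?case
    using aval_cong[of e \<eta> \<theta>] by simp
next
  case (POp f es)
  then have "map (pval \<eta>) es = map (pval \<theta>) es"
    by (intro map_cong) auto
  then show ?case
    by (simp only: pval.simps)
qed auto

lemma sat_cong: "(\<And>x. x \<in> gvars g \<Longrightarrow> \<eta> x = \<theta> x) \<Longrightarrow> sat \<eta> g \<longleftrightarrow> sat \<theta> g"
proof (induction g)
  case (Cmp R a b)
  then show ?case
    using aval_cong[of a \<eta> \<theta>] aval_cong[of b \<eta> \<theta>] by simp
qed auto

text \<open>For \<open>l\<close> the target of an update, this is the set subtracted in
  \<open>reset_set\<close>.\<close>

definition live_at :: "'v program \<Rightarrow> int \<Rightarrow> 'v set" where
  "live_at P l = (\<Union>c \<in> {c. c \<in># cmds P \<and> cf c = l}. live P c)"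

text \<open>Membership in \<open>Eval (vars P)\<close> gives access to the clause of
  \<open>program\<close> that makes the branch weights a distribution.\<close>

definition rvo_rel :: "'v program \<Rightarrow> 'v set \<Rightarrow> 'v state \<Rightarrow> 'v state \<Rightarrow> bool" where
  "rvo_rel P Exc s t \<longleftrightarrow> fst s = fst t \<and> snd s \<in> Eval (vars P) \<and>
     (\<forall>x \<in> Exc \<union> live_at P (fst s). snd s x = snd t x)"

lemma read_vars_live_at: "c \<in># cmds P \<Longrightarrow> x \<in> read_vars c \<Longrightarrow> x \<in> live_at P (cf c)"
  by (auto simp: live_at_def live_def intro: live_read)

text \<open>A single branch that leaves \<open>x\<close> unassigned keeps \<open>x\<close> out of
  \<open>written_vars c\<close>, so liveness propagates back to \<open>c\<close>.\<close>

lemma live_at_pred: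
  assumes "c \<in># cmds P" "(p, u) \<in> set (branches c)" "x \<in> live_at P (target u)"
    and "assigns u x = None"
  shows "x \<in> live_at P (cf c)"
proof -
  obtain c' where c': "c' \<in># cmds P" "cf c' = target u" "live_in P c' x"
    using assms(3) by (auto simp: live_at_def live_def)
  moreover have "c \<in> pred_cmds P c'"
    using assms(1,2) c'(2) by (auto simp: pred_cmds_def)
  moreover have "x \<notin> written_vars c"
    using assms(2,4) by (force simp: written_vars_def)
  ultimately have "live_in P c x"
    by (blast intro: live_prop)
  then show ?thesis
    using assms(1) by (auto simp: live_at_def live_def)
qed

text \<open>A variable in \<open>Exc\<close> or live at the target is not reset. If \<open>u\<close>
  leaves it alone, it was already in \<open>Exc\<close> or live at the source; otherwise its new
  value is computed from variables read by \<open>c\<close>, which are live there.\<close>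

lemma apply_update_rvo_rel:
  assumes P: "program P" and c: "c \<in># cmds P" "cf c = fst s"
    and u: "(p, u) \<in> set (branches c)" and rel: "rvo_rel P Exc s t"
  shows "rvo_rel P Exc (apply_update u (snd s)) (apply_update (rvo_update P \<rho> Exc c u) (snd t))"
proof -
  have dom: "dom (assigns u) \<subseteq> vars P"
    using P c(1) u by (fastforce simp: program_def)
  have eval: "snd (apply_update u (snd s)) \<in> Eval (vars P)"
    using rel dom
    by (fastforce simp: rvo_rel_def apply_update_def Eval_def PiE_def extensional_def
        split: option.splits)
  have "snd (apply_update u (snd s)) x = snd (apply_update (rvo_update P \<rho> Exc c u) (snd t)) x"
    if x: "x \<in> Exc \<union> live_at P (target u)" for x
  proof -
    have no_reset: "x \<notin> reset_set P Exc c u"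
      using x by (auto simp: reset_set_def live_at_def)
    show ?thesis
    proof (cases "assigns u x")
      case None
      then have "x \<in> Exc \<union> live_at P (fst s)"
        using x live_at_pred[OF c(1) u] c(2) by auto
      then show ?thesis
        using None no_reset rel by (simp add: apply_update_def rvo_update_def rvo_rel_def)
    next
      case (Some e)
      have "y \<in> live_at P (fst s)" if "y \<in> avars e" for y
        using that Some u read_vars_live_at[OF c(1), of y] c(2)
        by (fastforce simp: read_vars_def ran_def)
      then have "aval (snd s) e = aval (snd t) e"
        using rel by (intro aval_cong) (auto simp: rvo_rel_def)
      then show ?thesis
        using Some no_reset by (simp add: apply_update_def rvo_update_def)
    qed
  qed
  then show ?thesis
    using eval by (auto simp: rvo_rel_def apply_update_def rvo_update_def)
qed

text \<open>Guards at the current location read only variables live there, on which the two states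
  agree.\<close>

lemma enabled_rvo:
  assumes "rvo_rel P Exc s t"
  shows "enabled (rvo P \<rho> Exc) t = image_mset (rvo_command P \<rho> Exc) (enabled P s)"
proof -
  have "sat (snd t) (grd c) \<longleftrightarrow> sat (snd s) (grd c)" if "c \<in># cmds P" "cf c = fst s" for c
    using assms that read_vars_live_at[OF that(1)]
    by (intro sat_cong) (auto simp: rvo_rel_def read_vars_def)
  then have "filter_mset (\<lambda>c. cf c = fst t \<and> sat (snd t) (grd c)) (cmds P) = enabled P s"
    using assms unfolding enabled_def by (intro filter_mset_cong) (auto simp: rvo_rel_def)
  then show ?thesis
    by (simp add: enabled_def rvo_def rvo_command_def filter_mset_image_mset)
qed

lemma branches_rvo_rel:
  assumes P: "program P" and rel: "rvo_rel P Exc s t" and c: "c \<in># enabled P s"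
  shows "rel_pmf (rvo_rel P Exc)
      (pmf_of_list (map (\<lambda>(p, u). (u, pval (snd s) p)) (branches c)) \<bind>
        (\<lambda>u. return_pmf (apply_update u (snd s))))
      (pmf_of_list (map (\<lambda>(p, u). (u, pval (snd t) p)) (branches (rvo_command P \<rho> Exc c))) \<bind>
        (\<lambda>u. return_pmf (apply_update u (snd t))))"
proof -
  define xs where "xs = map (\<lambda>(p, u). (u, pval (snd s) p)) (branches c)"
  have c': "c \<in># cmds P" "cf c = fst s" "sat (snd s) (grd c)"
    using c by (auto simp: enabled_def)
  have wf: "pmf_of_list_wf xs"
    using P rel c' by (auto simp: program_def rvo_rel_def xs_def)
  have "pval (snd t) p = pval (snd s) p" if "(p, u) \<in> set (branches c)" for p u
    using rel that read_vars_live_at[OF c'(1)] c'(2)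
    by (intro pval_cong) (fastforce simp: rvo_rel_def read_vars_def)
  then have map_eq: "map (\<lambda>(p, u). (u, pval (snd t) p)) (branches (rvo_command P \<rho> Exc c)) =
      map (map_prod (rvo_update P \<rho> Exc c) id) xs"
    by (auto simp: rvo_command_def xs_def)
  \<comment> \<open>Both programs take the same branch; recording its membership in the list lets
    the update lemma apply.\<close>
  have "rel_pmf (\<lambda>u v. u = v \<and> u \<in> fst ` set xs) (pmf_of_list xs) (pmf_of_list xs)"
    using set_pmf_of_list[OF wf] by (intro rel_pmf_reflI) auto
  then show ?thesis
    unfolding map_eq pmf_of_list_map_fst[OF wf] bind_map_pmf xs_def[symmetric]
    by (rule rel_pmf_bindI)
      (use apply_update_rvo_rel[OF P c'(1,2) _ rel] in \<open>auto simp: xs_def\<close>)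
qed

text \<open>The coupling picks the same enabled command on both sides and then the same branch. With
  no enabled command both states are absorbing.\<close>

lemma step_rvo_rel:
  assumes P: "program P" and rel: "rvo_rel P Exc s t"
  shows "rel_pmf (rvo_rel P Exc) (step P s) (step (rvo P \<rho> Exc) t)"
proof (cases "enabled P s = {#}")
  case True
  then show ?thesis
    using rel by (simp add: step_def enabled_rvo[OF rel])
next
  case False
  then have "rel_pmf (\<lambda>c d. c = d \<and> c \<in># enabled P s)
      (pmf_of_multiset (enabled P s)) (pmf_of_multiset (enabled P s))"
    by (intro rel_pmf_reflI) auto
  with False show ?thesis
    by (simp add: step_def enabled_rvo[OF rel] pmf_of_multiset_image bind_map_pmf)
      (erule rel_pmf_bindI, use branches_rvo_rel[OF P rel] in simp)
qed

theorem theorem1: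
  fixes Prog :: "'v program" and Exc :: "'v set" and fail :: "'v guard"
    and k :: nat and \<rho> \<eta> :: "'v eval"
  assumes "program Prog"
    and "Exc \<subseteq> vars Prog"
    and "fail \<in> Guards Exc"
    and "\<rho> \<in> Eval (vars Prog)"
    and "\<eta> \<in> init_evals Prog"
  shows "measure (exec_measure Prog \<eta>) (reach_within k fail) =
         measure (exec_measure (rvo Prog \<rho> Exc) \<eta>) (reach_within k fail)"
proof (rule measure_reach_within_bisim[where R = "rvo_rel Prog Exc"])
  show "rvo_rel Prog Exc (0, \<eta>) (0, \<eta>)"
    using assms(5) by (simp add: rvo_rel_def init_evals_def)
  show "rel_pmf (rvo_rel Prog Exc) (step Prog s) (step (rvo Prog \<rho> Exc) t)"
    if "rvo_rel Prog Exc s t" for s t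
    using assms(1) that by (rule step_rvo_rel)
  show "sat (snd s) fail \<longleftrightarrow> sat (snd t) fail" if "rvo_rel Prog Exc s t" for s t
    using that assms(3) by (intro sat_cong) (auto simp: rvo_rel_def Guards_def)
qed (simp add: rvo_rel_def)

end
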